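(* Let $p_1\ge\dots\ge p_k$ be fixed with $\sum_{i=1}^kp_i=1$. Let $X$ denote the number of edges between classes (i.e. the number of queries comparing two elements lying in distinct partition classes) made by the random algorithm on an $n$-set. Then, as $n\to\infty$, $$\mathbb E[X]\sim \sum_{i<j}f(p_i,p_j)\,n,$$ where $$ f(\alpha,\beta)= \begin{cases} 2\alpha &\alpha=\beta,\\ \dfrac{2\alpha\beta\ln(\alpha/\beta)}{\alpha-\beta}&\alpha\ne\beta. \end{cases} $$
   Context: Setting: an $n$-set $S$ carries an unknown partition into a fixed number $k$ of classes $C_1,\dots,C_k$, generated randomly so that each element of $S$ independently belongs to class $C_i$ with probability $p_i$ (with $p_1\ge\dots\ge p_k$, $\sum_i p_i=1$). An active clustering (AC) algorithm recovers the partition by repeatedly choosing a pair of elements and asking an oracle whether they lie in the same class; it uses transitivity inside classes (it never queries a pair already known to be in the same class) and terminates when each class has been shown to be connected by positive answers and every pair of classes has been compared at least once. The random algorithm is the AC algorithm that, at each step, compares a pair chosen uniformly at random among all pairs whose relation is not yet known (i.e. neither known to belong to the same class nor known to belong to different classes).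
   Formalization: The random choice is uniform over unknown pairs of merged groups (elements joined by positive answers count as one), not over unknown pairs of single elements; under the latter the claimed formula fails, e.g. for p=(1/2,1/2) the limit of E[X]/n is below 1. *)

theory Defs
  imports "HOL-Probability.Probability" "HOL-Library.Landau_Symbols"
begin

text \<open>
  The ground set is \<open>{..<n}\<close> and a pair of distinct elements is represented as \<open>(x, y)\<close> with
  \<open>x < y\<close>.  A state of an active clustering algorithm consists of the set \<open>P\<close> of pairs queried
  so far with a positive answer and the set \<open>N\<close> of pairs queried so far with a negative answer.
\<close>

definition known_same :: "nat rel \<Rightarrow> nat rel" where
  "known_same P = (P \<union> P\<inverse>)\<^sup>*"

definition known_diff :: "nat rel \<Rightarrow> nat rel \<Rightarrow> nat rel" where
  "known_diff P N = known_same P O (N \<union> N\<inverse>) O known_same P"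

text \<open>
  Elements joined by positive answers are merged into a single item: by transitivity, all queries
  between two given merged items are the same question.  Hence a pair of current items counts once
  in the uniform choice below, however many elements have been merged into the two items.  A
  merged item is represented by its least element.
\<close>

definition items :: "nat \<Rightarrow> nat rel \<Rightarrow> nat set" where
  "items n P = {x. x < n \<and> (\<forall>z. (z, x) \<in> known_same P \<longrightarrow> x \<le> z)}"

definition unknown_pairs :: "nat \<Rightarrow> nat rel \<Rightarrow> nat rel \<Rightarrow> nat rel" where
  "unknown_pairs n P N =
     {(x, y). x \<in> items n P \<and> y \<in> items n P \<and> x < y \<and>
              (x, y) \<notin> known_same P \<and> (x, y) \<notin> known_diff P N}"

lemma finite_unknown_pairs [simp]: "finite (unknown_pairs n P N)"
  by (rule finite_subset[of _ "{..<n} \<times> {..<n}"]) (auto simp: unknown_pairs_def items_def)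

lemma unknown_pairs_not_queried:
  assumes "(x, y) \<in> unknown_pairs n P N"
  shows "(x, y) \<notin> P" "(x, y) \<notin> N"
  using assms by (auto simp: unknown_pairs_def known_diff_def known_same_def)

text \<open>
  The random algorithm, run from state \<open>(P, N)\<close> against the oracle \<open>same\<close>; the result is the
  distribution of the final state.  No unknown pair remains if and only if every class has been
  connected by positive answers and every two (nonempty) classes have been compared.
\<close>

function random_ac ::
  "nat \<Rightarrow> (nat \<Rightarrow> nat \<Rightarrow> bool) \<Rightarrow> nat rel \<Rightarrow> nat rel \<Rightarrow> (nat rel \<times> nat rel) pmf" where
  "random_ac n same P N =
     (if unknown_pairs n P N = {} then return_pmf (P, N)
      else bind_pmf (pmf_of_set (unknown_pairs n P N)) (\<lambda>e.
        if same (fst e) (snd e) then random_ac n same (insert e P) N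
        else random_ac n same P (insert e N)))"
  by pat_completeness auto
termination
proof (relation "Wellfounded.measure (\<lambda>(n, same, P, N). card ({..<n} \<times> {..<n} - (P \<union> N)))", goal_cases)
  case 1
  show ?case by simp
next
  case (2 n same P N e)
  then have "e \<in> unknown_pairs n P N" by simp
  then have "e \<in> {..<n} \<times> {..<n} - (P \<union> N)"
    using unknown_pairs_not_queried[of "fst e" "snd e" n P N]
    by (auto simp: unknown_pairs_def items_def)
  then have "{..<n} \<times> {..<n} - (insert e P \<union> N) \<subset> {..<n} \<times> {..<n} - (P \<union> N)" by blast
  then have "card ({..<n} \<times> {..<n} - (insert e P \<union> N)) < card ({..<n} \<times> {..<n} - (P \<union> N))"
    by (intro psubset_card_mono) simp_all
  then show ?case by (simp del: Un_insert_left Un_insert_right)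
next
  case (3 n same P N e)
  then have "e \<in> unknown_pairs n P N" by simp
  then have "e \<in> {..<n} \<times> {..<n} - (P \<union> N)"
    using unknown_pairs_not_queried[of "fst e" "snd e" n P N]
    by (auto simp: unknown_pairs_def items_def)
  then have "{..<n} \<times> {..<n} - (P \<union> insert e N) \<subset> {..<n} \<times> {..<n} - (P \<union> N)" by blast
  then have "card ({..<n} \<times> {..<n} - (P \<union> insert e N)) < card ({..<n} \<times> {..<n} - (P \<union> N))"
    by (intro psubset_card_mono) simp_all
  then show ?case by (simp del: Un_insert_left Un_insert_right)
qed

declare random_ac.simps [simp del]

definition class_pmf :: "nat \<Rightarrow> (nat \<Rightarrow> real) \<Rightarrow> nat pmf" where
  "class_pmf k p = embed_pmf (\<lambda>i. if i \<in> {1..k} then p i else 0)"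

lemma pmf_class_pmf:
  assumes "\<And>i. i \<in> {1..k} \<Longrightarrow> 0 \<le> p i" and "(\<Sum>i=1..k. p i) = 1"
  shows "pmf (class_pmf k p) i = (if i \<in> {1..k} then p i else 0)"
  unfolding class_pmf_def
proof (rule pmf_embed_pmf)
  show "0 \<le> (if x \<in> {1..k} then p x else 0)" for x using assms(1) by auto
  have "(\<integral>\<^sup>+x. ennreal (if x \<in> {1..k} then p x else 0) \<partial>count_space UNIV)
      = (\<Sum>x\<in>{1..k}. ennreal (if x \<in> {1..k} then p x else 0))"
    by (rule nn_integral_count_space') auto
  also have "\<dots> = (\<Sum>x\<in>{1..k}. ennreal (p x))"
    by (rule sum.cong) auto
  also have "\<dots> = ennreal (\<Sum>x=1..k. p x)"
    by (rule sum_ennreal) (use assms(1) in auto)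
  finally show "(\<integral>\<^sup>+x. ennreal (if x \<in> {1..k} then p x else 0) \<partial>count_space UNIV) = 1"
    using assms(2) by simp
qed

text \<open>The value \<open>0\<close> below is only the dummy class of the points outside \<open>{..<n}\<close>.\<close>

definition random_classes :: "nat \<Rightarrow> nat \<Rightarrow> (nat \<Rightarrow> real) \<Rightarrow> (nat \<Rightarrow> nat) pmf" where
  "random_classes n k p = Pi_pmf {..<n} 0 (\<lambda>_. class_pmf k p)"

text \<open>
  The oracle is truthful, so the queries between distinct classes are those answered negatively.
\<close>

definition inter_class_queries :: "nat \<Rightarrow> nat \<Rightarrow> (nat \<Rightarrow> real) \<Rightarrow> nat pmf" where
  "inter_class_queries n k p =
     bind_pmf (random_classes n k p) (\<lambda>c.
       map_pmf (\<lambda>(P, N). card N) (random_ac n (\<lambda>x y. c x = c y) {} {}))"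

definition edge_rate :: "real \<Rightarrow> real \<Rightarrow> real" where
  "edge_rate \<alpha> \<beta> = (if \<alpha> = \<beta> then 2 * \<alpha> else 2 * \<alpha> * \<beta> * ln (\<alpha> / \<beta>) / (\<alpha> - \<beta>))"

end

theory Submission
  imports Defs "HOL-Real_Asymp.Real_Asymp"
begin

text \<open>
  Fix two classes with \<open>a\<close> and \<open>b\<close> current items and \<open>m\<close> queries between them so far.  An unknown
  pair is uniformly distributed, so up to a common factor the process merges items of the first
  class at rate \<open>a choose 2\<close> and of the second at rate \<open>b choose 2\<close>, and compares the two classes at
  rate \<open>u\<close>, the number of unknown cross pairs, with \<open>a * b - m \<le> u \<le> a * b\<close>.  The other classes only
  slow this down.  If \<open>u\<close> were \<open>a * b\<close> and the process continuous, \<open>m + f(a, b)\<close> would have drift zero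
  exactly when \<open>(a\<^sup>2/2) f\<^sub>a + (b\<^sup>2/2) f\<^sub>b = a * b\<close>, which is solved by
  \<open>f(a, b) = \<integral>\<^sub>0\<^sup>1 2ab / (xa + (1 - x)b) dx\<close>, the function of the theorem.  The discrete process deviates
  from this by lower order terms, so that \<open>f\<close> can be corrected to a supermartingale and to a
  submartingale.  Hence the expected number of queries between the classes is \<open>f\<close> of the class sizes
  up to \<open>o(n)\<close>.  As \<open>f\<close> is monotone and homogeneous of degree one, the concentration of the class
  sizes around \<open>p\<^sub>i n\<close> gives the claim.
\<close>

subsection \<open>Items and unknown pairs\<close>

definition consistent :: "nat \<Rightarrow> (nat \<Rightarrow> nat) \<Rightarrow> nat rel \<Rightarrow> nat rel \<Rightarrow> bool" where
  "consistent n c P N \<longleftrightarrow>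
     P \<subseteq> {(x, y). x < n \<and> y < n \<and> c x = c y} \<and> N \<subseteq> {(x, y). x < n \<and> y < n \<and> c x \<noteq> c y}"

definition class_items :: "nat \<Rightarrow> (nat \<Rightarrow> nat) \<Rightarrow> nat rel \<Rightarrow> nat \<Rightarrow> nat set" where
  "class_items n c P i = {x \<in> items n P. c x = i}"

definition cross_pairs :: "(nat \<Rightarrow> nat) \<Rightarrow> nat \<Rightarrow> nat \<Rightarrow> nat rel \<Rightarrow> nat rel" where
  "cross_pairs c i j R = {(x, y) \<in> R. {c x, c y} = {i, j}}"

definition inner_pairs :: "(nat \<Rightarrow> nat) \<Rightarrow> nat \<Rightarrow> nat rel \<Rightarrow> nat rel" where
  "inner_pairs c i R = {(x, y) \<in> R. c x = i \<and> c y = i}"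

definition rep :: "nat rel \<Rightarrow> nat \<Rightarrow> nat" where
  "rep P x = (LEAST z. (z, x) \<in> known_same P)"

lemma known_same_refl [simp]: "(x, x) \<in> known_same P"
  by (simp add: known_same_def)

lemma known_same_sym: "(x, y) \<in> known_same P \<Longrightarrow> (y, x) \<in> known_same P"
  unfolding known_same_def by (metis converse_Un converse_converse rtrancl_converseD sup_commute converse_iff)

lemma known_same_trans:
  "(x, y) \<in> known_same P \<Longrightarrow> (y, z) \<in> known_same P \<Longrightarrow> (x, z) \<in> known_same P"
  unfolding known_same_def by (rule rtrancl_trans)

lemma known_same_insert:
  "known_same (insert (x, y) P) =
     known_same P \<union> {(u, v). (u, x) \<in> known_same P \<and> (y, v) \<in> known_same P}
       \<union> {(u, v). (u, y) \<in> known_same P \<and> (x, v) \<in> known_same P}"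
proof -
  have "insert (x, y) P \<union> (insert (x, y) P)\<inverse> = insert (x, y) (insert (y, x) (P \<union> P\<inverse>))" by auto
  then have "known_same (insert (x, y) P) = (insert (x, y) (insert (y, x) (P \<union> P\<inverse>)))\<^sup>*"
    by (simp add: known_same_def)
  also have "\<dots> = known_same P \<union> {(u, v). (u, x) \<in> known_same P \<and> (y, v) \<in> known_same P}
       \<union> {(u, v). (u, y) \<in> known_same P \<and> (x, v) \<in> known_same P}"
    unfolding rtrancl_insert known_same_def[symmetric]
    by (auto intro: known_same_trans known_same_sym)
  finally show ?thesis .
qed

lemma known_same_class:
  assumes "consistent n c P N" "(x, y) \<in> known_same P"
  shows "c x = c y"
  using assms(2) unfolding known_same_def
  by (induction rule: rtrancl_induct) (use assms(1) in \<open>auto simp: consistent_def\<close>)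

lemma items_eqI:
  assumes "x \<in> items n P" "y \<in> items n P" "(x, y) \<in> known_same P"
  shows "x = y"
  using assms known_same_sym[OF assms(3)] by (simp add: items_def le_antisym)

lemma rep_known_same: "(rep P x, x) \<in> known_same P"
  unfolding rep_def by (rule LeastI[of _ x]) simp

lemma rep_items:
  assumes "x < n" shows "rep P x \<in> items n P"
proof -
  have least: "rep P x \<le> z" if "(z, x) \<in> known_same P" for z
    using that unfolding rep_def by (rule Least_le)
  have "rep P x \<le> z" if "(z, rep P x) \<in> known_same P" for z
    using least known_same_trans[OF that rep_known_same] .
  moreover have "rep P x < n" using least[of x] assms by simp
  ultimately show ?thesis by (simp add: items_def)
qed

lemma rep_eqI: "x \<in> items n P \<Longrightarrow> y < n \<Longrightarrow> (x, y) \<in> known_same P \<Longrightarrow> rep P y = x"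
  by (meson items_eqI known_same_sym known_same_trans rep_items rep_known_same)

lemma known_diff_sym: "(x, y) \<in> known_diff P N \<Longrightarrow> (y, x) \<in> known_diff P N"
  unfolding known_diff_def by (blast intro: known_same_sym)

lemma known_diff_class:
  assumes "consistent n c P N" "(x, y) \<in> known_diff P N"
  shows "c x \<noteq> c y"
proof -
  obtain u v where uv: "(x, u) \<in> known_same P" "(u, v) \<in> N \<union> N\<inverse>" "(v, y) \<in> known_same P"
    using assms(2) unfolding known_diff_def by blast
  have "c u \<noteq> c v" using assms(1) uv(2) by (auto simp: consistent_def)
  then show ?thesis using known_same_class[OF assms(1)] uv(1,3) by metis
qed

lemma consistent_finite:
  assumes "consistent n c P N" shows "finite N"
  by (rule finite_subset[of _ "{..<n} \<times> {..<n}"]) (use assms in \<open>auto simp: consistent_def\<close>)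

lemma finite_class_items [simp]: "finite (class_items n c P i)"
  by (rule finite_subset[of _ "{..<n}"]) (auto simp: class_items_def items_def)

lemma consistent_insert:
  assumes "consistent n c P N" "(x, y) \<in> unknown_pairs n P N"
  shows "c x = c y \<Longrightarrow> consistent n c (insert (x, y) P) N"
    and "c x \<noteq> c y \<Longrightarrow> consistent n c P (insert (x, y) N)"
  using assms by (auto simp: consistent_def unknown_pairs_def items_def)

lemma class_items_insert:
  assumes "consistent n c P N" "(x, y) \<in> unknown_pairs n P N" "c x = c y"
  shows "class_items n c (insert (x, y) P) i = class_items n c P i - {y}"
proof -
  have xy: "x \<in> items n P" "y \<in> items n P" "x < y" using assms(2) by (auto simp: unknown_pairs_def)
  have "items n (insert (x, y) P) = items n P - {y}"
  proof (intro equalityI subsetI)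
    fix z assume z: "z \<in> items n (insert (x, y) P)"
    have "(x, y) \<in> known_same (insert (x, y) P)" by (simp add: known_same_insert)
    with z xy(3) have "z \<noteq> y" by (auto simp: items_def)
    moreover have "z \<in> items n P" using z by (auto simp: items_def known_same_insert)
    ultimately show "z \<in> items n P - {y}" by simp
  next
    fix z assume z: "z \<in> items n P - {y}"
    have "z \<le> w" if w: "(w, z) \<in> known_same (insert (x, y) P)" for w
    proof -
      consider "(w, z) \<in> known_same P" | "(y, z) \<in> known_same P"
        | "(w, y) \<in> known_same P" "(x, z) \<in> known_same P"
        using w by (auto simp: known_same_insert)
      then show ?thesis
      proof cases
        case 1 then show ?thesis using z by (auto simp: items_def)
      next
        case 2 then show ?thesis using z xy items_eqI by blast
      next
        case 3
        then have "z = x" "y \<le> w" using z xy items_eqI by (blast, auto simp: items_def)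
        then show ?thesis using xy by simp
      qed
    qed
    then show "z \<in> items n (insert (x, y) P)" using z by (auto simp: items_def)
  qed
  then show ?thesis by (auto simp: class_items_def)
qed

lemma card_increasing_pairs:
  fixes A :: "'a::linorder set"
  assumes "finite A"
  shows "2 * card {(x, y). x \<in> A \<and> y \<in> A \<and> x < y} + card A = card A * card A"
proof -
  let ?L = "{(x, y). x \<in> A \<and> y \<in> A \<and> x < y}"
  have fin: "finite ?L" by (rule finite_subset[of _ "A \<times> A"]) (use assms in auto)
  have "A \<times> A = ?L \<union> (prod.swap ` ?L \<union> (\<lambda>x. (x, x)) ` A)"
    by (auto simp: image_iff)
  then have "card A * card A = card (?L \<union> (prod.swap ` ?L \<union> (\<lambda>x. (x, x)) ` A))"
    using card_cartesian_product[of A A] by argo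
  also have "\<dots> = card ?L + (card (prod.swap ` ?L) + card ((\<lambda>x. (x, x)) ` A))"
    using fin assms by (subst card_Un_disjoint; (subst card_Un_disjoint)?) auto
  also have "card (prod.swap ` ?L) = card ?L" by (rule card_image) simp
  also have "card ((\<lambda>x. (x, x)) ` A) = card A" by (rule card_image) (simp add: inj_on_def)
  finally show ?thesis by simp
qed

lemma card_inner_unknown:
  assumes "consistent n c P N"
  shows "2 * real (card (inner_pairs c i (unknown_pairs n P N))) =
           real (card (class_items n c P i)) * (real (card (class_items n c P i)) - 1)"
proof -
  have "inner_pairs c i (unknown_pairs n P N) =
      {(x, y). x \<in> class_items n c P i \<and> y \<in> class_items n c P i \<and> x < y}"
    using known_diff_class[OF assms] items_eqI
    by (fastforce simp: inner_pairs_def unknown_pairs_def class_items_def)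
  then show ?thesis
    using arg_cong[OF card_increasing_pairs[of "class_items n c P i"], of real]
    by (simp add: algebra_simps)
qed

lemma card_cross_unknown:
  fixes n c P N i j
  defines "a \<equiv> card (class_items n c P i)" and "b \<equiv> card (class_items n c P j)"
    and "m \<equiv> card (cross_pairs c i j N)"
    and "u \<equiv> card (cross_pairs c i j (unknown_pairs n P N))"
  assumes cons: "consistent n c P N" and ij: "i \<noteq> j"
  shows "u \<le> a * b" "a * b \<le> u + m" "m > 0 \<Longrightarrow> u < a * b"
proof -
  let ?A = "class_items n c P i" and ?B = "class_items n c P j"
  define D where "D = {(s, t) \<in> ?A \<times> ?B. (s, t) \<in> known_diff P N}"
  define h where "h = (\<lambda>(x, y). if c x = i then (rep P x, rep P y) else (rep P y, rep P x))"
  have crep: "c (rep P x) = c x" for x using known_same_class[OF cons rep_known_same] .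
  have D: "D = h ` cross_pairs c i j N"
  proof (intro equalityI subsetI)
    fix e assume "e \<in> D"
    then obtain s t where e: "e = (s, t)" "s \<in> ?A" "t \<in> ?B" "(s, t) \<in> known_diff P N"
      by (auto simp: D_def)
    then obtain x y where xy: "(s, x) \<in> known_same P" "(x, y) \<in> N \<union> N\<inverse>" "(y, t) \<in> known_same P"
      unfolding known_diff_def by blast
    have "x < n" "y < n" using xy(2) cons by (auto simp: consistent_def)
    then have r: "rep P x = s" "rep P y = t"
      using e xy known_same_sym by (auto intro!: rep_eqI simp: class_items_def)
    have c: "c x = i" "c y = j" using crep[of x] crep[of y] r e by (auto simp: class_items_def)
    show "e \<in> h ` cross_pairs c i j N"
    proof (cases "(x, y) \<in> N")
      case True
      then show ?thesis using c r e
        by (intro image_eqI[of _ _ "(x, y)"]) (auto simp: h_def cross_pairs_def)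
    next
      case False
      then show ?thesis using c r e ij xy(2)
        by (intro image_eqI[of _ _ "(y, x)"]) (auto simp: h_def cross_pairs_def)
    qed
  next
    fix e assume "e \<in> h ` cross_pairs c i j N"
    then obtain x y where e: "e = h (x, y)" "(x, y) \<in> N" "{c x, c y} = {i, j}"
      by (auto simp: cross_pairs_def)
    have lt: "x < n" "y < n" using e(2) cons by (auto simp: consistent_def)
    have "(rep P x, rep P y) \<in> known_diff P N"
      using e(2) rep_known_same[of P x] known_same_sym[OF rep_known_same[of P y]]
      unfolding known_diff_def by blast
    then show "e \<in> D"
      using e ij lt rep_items crep known_diff_sym
      by (auto simp: D_def h_def class_items_def doubleton_eq_iff)
  qed
  have Dsub: "D \<subseteq> ?A \<times> ?B" by (auto simp: D_def)
  have finN: "finite (cross_pairs c i j N)"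
    using consistent_finite[OF cons] by (rule rev_finite_subset) (auto simp: cross_pairs_def)
  have "bij_betw (\<lambda>(s, t). (min s t, max s t)) (?A \<times> ?B - D)
          (cross_pairs c i j (unknown_pairs n P N))"
  proof (rule bij_betwI[where g = "\<lambda>(x, y). if c x = i then (x, y) else (y, x)"], goal_cases)
    case 1
    show ?case
    proof (rule Pi_I, clarify)
      fix s t assume st: "s \<in> ?A" "t \<in> ?B" "(s, t) \<notin> D"
      then have "s \<noteq> t" "(s, t) \<notin> known_diff P N" "(t, s) \<notin> known_diff P N"
        using ij known_diff_sym by (auto simp: D_def class_items_def)
      moreover have "(s, t) \<notin> known_same P" "(t, s) \<notin> known_same P"
        using st ij known_same_class[OF cons] by (auto simp: class_items_def)
      ultimately show "(min s t, max s t) \<in> cross_pairs c i j (unknown_pairs n P N)"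
        using st by (auto simp: cross_pairs_def unknown_pairs_def class_items_def min_def max_def)
    qed
  next
    case 2
    show ?case using ij known_diff_sym
      by (auto simp: cross_pairs_def unknown_pairs_def class_items_def D_def doubleton_eq_iff)
  next
    case (3 e)
    then show ?case using ij by (auto simp: class_items_def min_def max_def)
  next
    case (4 e)
    then show ?case by (auto simp: cross_pairs_def unknown_pairs_def)
  qed
  then have "u = card (?A \<times> ?B - D)" unfolding u_def by (simp add: bij_betw_same_card)
  also have "\<dots> = a * b - card D"
    unfolding a_def b_def using Dsub
    by (subst card_Diff_subset) (auto intro: finite_subset simp: card_cartesian_product)
  finally have u: "u = a * b - card D" .
  have Dle: "card D \<le> a * b"
    unfolding a_def b_def card_cartesian_product[symmetric] using Dsub by (intro card_mono) auto
  show "u \<le> a * b" using u by simp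
  have "card D \<le> m" unfolding D m_def using finN by (rule card_image_le)
  then show "a * b \<le> u + m" using u by simp
  assume "m > 0"
  then have "D \<noteq> {}" unfolding D m_def by auto
  then have "card D > 0" using Dsub by (simp add: card_gt_0_iff finite_subset)
  then show "u < a * b" using u Dle by simp
qed

subsection \<open>Drift of functions of the state\<close>

lemma finite_set_random_ac [simp]: "finite (set_pmf (random_ac n same P N))"
proof (induction n same P N rule: random_ac.induct)
  case (1 n same P N)
  then show ?case
    by (subst random_ac.simps) (auto simp: set_pmf_of_set)
qed

lemma random_ac_final:
  assumes "consistent n c P N" "(P', N') \<in> set_pmf (random_ac n (\<lambda>x y. c x = c y) P N)"
  shows "consistent n c P' N' \<and> unknown_pairs n P' N' = {}"
  using assms
proof (induction n "\<lambda>x y. c x = c y" P N rule: random_ac.induct)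
  case (1 n P N)
  show ?case
  proof (cases "unknown_pairs n P N = {}")
    case True
    then show ?thesis using 1 by (auto simp: random_ac.simps[of n _ P N])
  next
    case False
    then obtain x y where xy: "(x, y) \<in> unknown_pairs n P N"
      "(P', N') \<in> set_pmf (if c x = c y then random_ac n (\<lambda>x y. c x = c y) (insert (x, y) P) N
        else random_ac n (\<lambda>x y. c x = c y) P (insert (x, y) N))"
      using "1.prems"(2) by (subst (asm) (3) random_ac.simps) (auto simp: set_pmf_of_set)
    then show ?thesis
      using 1(1)[OF False, of "(x, y)"] 1(2)[OF False, of "(x, y)"]
        consistent_insert[OF "1.prems"(1) xy(1)] False
      by (cases "c x = c y") auto
  qed
qed

lemma expectation_random_ac_le:
  fixes \<Psi> :: "nat rel \<Rightarrow> nat rel \<Rightarrow> real"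
  assumes "consistent n c P N"
    and "\<And>P N. consistent n c P N \<Longrightarrow>
      (\<Sum>(x, y)\<in>unknown_pairs n P N.
         (if c x = c y then \<Psi> (insert (x, y) P) N else \<Psi> P (insert (x, y) N)) - \<Psi> P N) \<le> 0"
  shows "measure_pmf.expectation (random_ac n (\<lambda>x y. c x = c y) P N) (\<lambda>(P, N). \<Psi> P N) \<le> \<Psi> P N"
  using assms
proof (induction n "\<lambda>x y. c x = c y" P N rule: random_ac.induct)
  case (1 n P N)
  let ?U = "unknown_pairs n P N" and ?R = "random_ac n (\<lambda>x y. c x = c y)"
  let ?E = "\<lambda>P N. measure_pmf.expectation (?R P N) (\<lambda>(P, N). \<Psi> P N)"
  show ?case
  proof (cases "?U = {}")
    case True
    then show ?thesis by (simp add: random_ac.simps[of n _ P N])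
  next
    case False
    let ?next = "\<lambda>x y. if c x = c y then \<Psi> (insert (x, y) P) N else \<Psi> P (insert (x, y) N)"
    have card: "real (card ?U) > 0" using False by (simp add: card_gt_0_iff)
    have step: "(if c x = c y then ?E (insert (x, y) P) N else ?E P (insert (x, y) N)) \<le> ?next x y"
      if "(x, y) \<in> ?U" for x y
      using 1(1)[OF False, of "(x, y)"] 1(2)[OF False, of "(x, y)"] that
        consistent_insert[OF "1.prems"(1) that] "1.prems"(2) False by auto
    have "?E P N = (\<Sum>(x, y)\<in>?U.
        (if c x = c y then ?E (insert (x, y) P) N else ?E P (insert (x, y) N)) / real (card ?U))"
      using False
      by (subst random_ac.simps, simp, subst pmf_expectation_bind_pmf_of_set)
         (simp_all add: split_def if_distrib[of "\<lambda>M. measure_pmf.expectation M _"]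
            divide_inverse mult.commute cong: if_cong)
    also have "\<dots> \<le> (\<Sum>(x, y)\<in>?U. ?next x y / real (card ?U))"
    proof (rule sum_mono, clarify)
      fix x y assume "(x, y) \<in> ?U"
      then show "(if c x = c y then ?E (insert (x, y) P) N else ?E P (insert (x, y) N))
          / real (card ?U) \<le> ?next x y / real (card ?U)"
        using step card by (intro divide_right_mono) simp_all
    qed
    also have "\<dots> = (\<Sum>(x, y)\<in>?U. ?next x y) / real (card ?U)"
      by (simp add: sum_divide_distrib case_prod_unfold)
    also have "\<dots> \<le> \<Psi> P N"
      using "1.prems"(2)[OF "1.prems"(1)] card
      by (simp add: case_prod_unfold sum_subtractf field_simps)
    finally show ?thesis .
  qed
qed

text \<open>
  For two classes the triple of the numbers of their items and the number of queries between them
  drives the process: \<open>a choose 2\<close> and \<open>b choose 2\<close> of the unknown pairs merge items of one class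
  and \<open>u\<close> of them are cross pairs, while all other pairs leave the triple unchanged.
\<close>

lemma expectation_two_classes_le:
  fixes \<Theta> :: "nat \<Rightarrow> nat \<Rightarrow> nat \<Rightarrow> real"
  assumes ij: "i \<noteq> j"
    and super: "\<And>a b m u. u \<le> a * b \<Longrightarrow> a * b \<le> u + m \<Longrightarrow> (m > 0 \<Longrightarrow> u < a * b) \<Longrightarrow>
      real a * (real a - 1) / 2 * (\<Theta> (a - 1) b m - \<Theta> a b m) +
      real b * (real b - 1) / 2 * (\<Theta> a (b - 1) m - \<Theta> a b m) +
      real u * (\<Theta> a b (Suc m) - \<Theta> a b m) \<le> 0"
  shows "measure_pmf.expectation (random_ac n (\<lambda>x y. c x = c y) {} {})
      (\<lambda>(P, N). \<Theta> (card (class_items n c P i)) (card (class_items n c P j))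
         (card (cross_pairs c i j N)))
    \<le> \<Theta> (card {x. x < n \<and> c x = i}) (card {x. x < n \<and> c x = j}) 0"
proof -
  let ?\<Psi> = "\<lambda>P N. \<Theta> (card (class_items n c P i)) (card (class_items n c P j))
         (card (cross_pairs c i j N))"
  have "measure_pmf.expectation (random_ac n (\<lambda>x y. c x = c y) {} {}) (\<lambda>(P, N). ?\<Psi> P N)
      \<le> ?\<Psi> {} {}"
  proof (rule expectation_random_ac_le)
    fix P N assume cons: "consistent n c P N"
    define a b m where "a = card (class_items n c P i)" and "b = card (class_items n c P j)"
      and "m = card (cross_pairs c i j N)"
    let ?U = "unknown_pairs n P N"
    let ?I = "inner_pairs c i ?U" and ?J = "inner_pairs c j ?U" and ?C = "cross_pairs c i j ?U"
    let ?d = "\<lambda>(x, y). (if c x = c y then ?\<Psi> (insert (x, y) P) N else ?\<Psi> P (insert (x, y) N)) - ?\<Psi> P N"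
    have finN: "finite (cross_pairs c i j N)"
      using consistent_finite[OF cons] by (rule rev_finite_subset) (auto simp: cross_pairs_def)
    have sub: "?I \<subseteq> ?U" "?J \<subseteq> ?U" "?C \<subseteq> ?U"
      by (auto simp: inner_pairs_def cross_pairs_def)
    then have fin: "finite ?I" "finite ?J" "finite ?C" by (auto intro: finite_subset)
    have rest: "?d e = 0" if "e \<in> ?U - (?I \<union> ?J \<union> ?C)" for e
    proof -
      obtain x y where e: "e = (x, y)" by (cases e)
      show ?thesis
      proof (cases "c x = c y")
        case True
        have "class_items n c P i - {y} = class_items n c P i"
          "class_items n c P j - {y} = class_items n c P j"
          using that e True by (auto simp: inner_pairs_def class_items_def)
        then show ?thesis
          using that True class_items_insert[OF cons, of x y] by (simp add: e)
      next
        case False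
        then have "cross_pairs c i j (insert (x, y) N) = cross_pairs c i j N"
          using that e by (auto simp: cross_pairs_def)
        then show ?thesis using False by (simp add: e)
      qed
    qed
    have I: "?d e = \<Theta> (a - 1) b m - \<Theta> a b m" if "e \<in> ?I" for e
    proof -
      obtain x y where e: "e = (x, y)" by (cases e)
      have "y \<in> class_items n c P i" "class_items n c P j - {y} = class_items n c P j"
        using that e ij by (auto simp: inner_pairs_def class_items_def unknown_pairs_def)
      moreover have "c x = c y" "(x, y) \<in> ?U" using that e by (auto simp: inner_pairs_def)
      ultimately show ?thesis
        using class_items_insert[OF cons, of x y] by (simp add: e a_def b_def m_def)
    qed
    have J: "?d e = \<Theta> a (b - 1) m - \<Theta> a b m" if "e \<in> ?J" for e
    proof -
      obtain x y where e: "e = (x, y)" by (cases e)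
      have "y \<in> class_items n c P j" "class_items n c P i - {y} = class_items n c P i"
        using that e ij by (auto simp: inner_pairs_def class_items_def unknown_pairs_def)
      moreover have "c x = c y" "(x, y) \<in> ?U" using that e by (auto simp: inner_pairs_def)
      ultimately show ?thesis
        using class_items_insert[OF cons, of x y] by (simp add: e a_def b_def m_def)
    qed
    have C: "?d e = \<Theta> a b (Suc m) - \<Theta> a b m" if "e \<in> ?C" for e
    proof -
      obtain x y where e: "e = (x, y)" by (cases e)
      have "(x, y) \<notin> N" using that e unknown_pairs_not_queried(2) by (auto simp: cross_pairs_def)
      moreover have "cross_pairs c i j (insert (x, y) N) = insert (x, y) (cross_pairs c i j N)"
        using that e by (auto simp: cross_pairs_def)
      moreover have "c x \<noteq> c y" using that e ij by (auto simp: cross_pairs_def)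
      ultimately show ?thesis using finN by (simp add: e a_def b_def m_def cross_pairs_def)
    qed
    have "sum ?d ?U = sum ?d (?I \<union> ?J \<union> ?C)"
      using rest sub by (intro sum.mono_neutral_right) auto
    also have "\<dots> = sum ?d ?I + sum ?d ?J + sum ?d ?C"
      using fin ij
      by (subst sum.union_disjoint; (subst sum.union_disjoint)?)
         (auto simp: inner_pairs_def cross_pairs_def)
    also have "\<dots> = real (card ?I) * (\<Theta> (a - 1) b m - \<Theta> a b m)
        + real (card ?J) * (\<Theta> a (b - 1) m - \<Theta> a b m)
        + real (card ?C) * (\<Theta> a b (Suc m) - \<Theta> a b m)"
      by (simp add: I J C cong: sum.cong)
    also have "real (card ?I) = real a * (real a - 1) / 2"
      using card_inner_unknown[OF cons, of i] by (simp add: a_def)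
    also have "real (card ?J) = real b * (real b - 1) / 2"
      using card_inner_unknown[OF cons, of j] by (simp add: b_def)
    also have "real a * (real a - 1) / 2 * (\<Theta> (a - 1) b m - \<Theta> a b m)
        + real b * (real b - 1) / 2 * (\<Theta> a (b - 1) m - \<Theta> a b m)
        + real (card ?C) * (\<Theta> a b (Suc m) - \<Theta> a b m) \<le> 0"
      using card_cross_unknown[OF cons ij] by (intro super) (auto simp: a_def b_def m_def)
    finally show "sum ?d ?U \<le> 0" .
  qed (simp add: consistent_def)
  moreover have "items n {} = {..<n}" by (auto simp: items_def known_same_def)
  ultimately show ?thesis by (simp add: class_items_def cross_pairs_def)
qed

subsection \<open>The rate as an integral\<close>

text \<open>
  Unlike the closed form of \<open>edge_rate\<close>, the integral below needs no case distinction, and its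
  monotonicity, homogeneity and merging inequalities can be read off the integrand.
\<close>

definition wharm :: "real \<Rightarrow> real \<Rightarrow> real \<Rightarrow> real" where
  "wharm x a b = a * b / (x * a + (1 - x) * b)"

definition pair_cost :: "real \<Rightarrow> real \<Rightarrow> real" where
  "pair_cost a b = integral {0..1} (\<lambda>x. 2 * wharm x a b)"

lemma wharm_denom_pos:
  assumes "0 \<le> x" "x \<le> 1" "0 < a" "0 < b"
  shows "0 < x * a + (1 - x) * (b::real)"
  using assms by (cases "x = 0") (auto intro: add_pos_nonneg)

lemma wharm_0 [simp]: "wharm x 0 b = 0" "wharm x a 0 = 0"
  by (simp_all add: wharm_def)

lemma wharm_nonneg: "0 \<le> x \<Longrightarrow> x \<le> 1 \<Longrightarrow> 0 \<le> a \<Longrightarrow> 0 \<le> b \<Longrightarrow> 0 \<le> wharm x a b"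
  by (simp add: wharm_def)

lemma wharm_swap: "wharm x a b = wharm (1 - x) b a"
  by (simp add: wharm_def algebra_simps)

lemma wharm_scale: "t \<noteq> 0 \<Longrightarrow> wharm x (t * a) (t * b) = t * wharm x a b"
proof -
  assume "t \<noteq> 0"
  moreover have "x * (t * a) + (1 - x) * (t * b) = t * (x * a + (1 - x) * b)"
    by (simp add: algebra_simps)
  ultimately show ?thesis by (simp add: wharm_def)
qed

lemma wharm_mono_left:
  assumes x: "0 \<le> x" "x \<le> 1" and "0 \<le> a" "a \<le> a'" "0 \<le> b"
  shows "wharm x a b \<le> wharm x a' b"
proof (cases "a = 0 \<or> b = 0")
  case True
  then show ?thesis using assms wharm_nonneg by auto
next
  case False
  then have pos: "0 < a" "0 < b" "0 < a'" using assms by auto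
  have "a * b * (x * a' + (1 - x) * b) \<le> a' * b * (x * a + (1 - x) * b)"
  proof -
    have "0 \<le> (a' - a) * (b * ((1 - x) * b))" using assms by simp
    then show ?thesis by (simp add: algebra_simps)
  qed
  then show ?thesis
    unfolding wharm_def using wharm_denom_pos[OF x] pos by (simp add: divide_simps)
qed

lemma wharm_mono_right:
  "0 \<le> x \<Longrightarrow> x \<le> 1 \<Longrightarrow> 0 \<le> a \<Longrightarrow> 0 \<le> b \<Longrightarrow> b \<le> b' \<Longrightarrow> wharm x a b \<le> wharm x a b'"
  using wharm_mono_left[of "1 - x" b b' a] by (simp add: wharm_swap[of x])

lemma wharm_le_mean:
  assumes x: "0 \<le> x" "x \<le> 1" and "0 \<le> a" "0 \<le> b"
  shows "wharm x a b \<le> x * b + (1 - x) * a"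
proof (cases "a = 0 \<or> b = 0")
  case True
  then show ?thesis using assms by auto
next
  case False
  then have pos: "0 < a" "0 < b" using assms by auto
  have "(x * b + (1 - x) * a) * (x * a + (1 - x) * b) - a * b = x * (1 - x) * (a - b)\<^sup>2"
    by (simp add: algebra_simps power2_eq_square)
  moreover have "0 \<le> x * (1 - x) * (a - b)\<^sup>2" using x by simp
  ultimately show ?thesis
    unfolding wharm_def using wharm_denom_pos[OF x pos] by (simp add: divide_le_eq)
qed

lemma wharm_bound_left:
  assumes x: "0 \<le> x" "x \<le> 1" and "0 \<le> a" "0 \<le> b"
  shows "(1 - x) * wharm x a b \<le> a"
proof (cases "a = 0 \<or> b = 0")
  case True
  then show ?thesis using assms by auto
next
  case False
  then have pos: "0 < a" "0 < b" using assms by auto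
  have "0 \<le> a * (x * a)" using x pos by simp
  then have "(1 - x) * (a * b) \<le> a * (x * a + (1 - x) * b)" by (simp add: algebra_simps)
  then show ?thesis
    unfolding wharm_def using wharm_denom_pos[OF x pos] by (simp add: divide_le_eq)
qed

lemma wharm_step:
  assumes x: "0 \<le> x" "x \<le> 1" and "1 \<le> a" "0 \<le> b"
  shows "a * (a - 1) * (wharm x a b - wharm x (a - 1) b) = (1 - x) * wharm x a b * wharm x (a - 1) b"
proof (cases "a = 1 \<or> b = 0")
  case False
  then have "0 < x * a + (1 - x) * b" "0 < x * (a - 1) + (1 - x) * b"
    using wharm_denom_pos[OF x] assms by auto
  then show ?thesis unfolding wharm_def by (simp add: divide_simps) algebra
qed auto

lemma continuous_on_wharm:
  assumes "0 \<le> a" "0 \<le> b"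
  shows "continuous_on {0..1} (\<lambda>x. wharm x a b)"
proof (cases "a = 0 \<or> b = 0")
  case False
  then have "x * a + (1 - x) * b \<noteq> 0" if "x \<in> {0..1}" for x
    using wharm_denom_pos[of x a b] that assms by auto
  then show ?thesis unfolding wharm_def by (intro continuous_intros) auto
qed auto

lemma wharm_integrable [intro, simp]:
  assumes "0 \<le> a" "0 \<le> b"
  shows "(\<lambda>x. wharm x a b) integrable_on {0..1}"
  using continuous_on_wharm[OF assms] by (rule integrable_continuous_interval)

lemma has_integral_pair_cost:
  assumes "0 \<le> a" "0 \<le> b"
  shows "((\<lambda>x. 2 * wharm x a b) has_integral pair_cost a b) {0..1}"
  unfolding pair_cost_def using assms
  by (intro integrable_integral integrable_on_mult_right wharm_integrable)

lemma has_integral_wharm_square: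
  assumes "0 \<le> a" "0 \<le> b"
  shows "((\<lambda>x. (wharm x a b)\<^sup>2) has_integral a * b) {0..1}"
proof (cases "a = 0 \<or> b = 0")
  case False
  then have pos: "0 < a" "0 < b" using assms by auto
  have "((\<lambda>x. (wharm x a b)\<^sup>2) has_integral
      (a\<^sup>2 * b * 1 / (1 * a + (1 - 1) * b) - a\<^sup>2 * b * 0 / (0 * a + (1 - 0) * b))) {0..1}"
  proof (rule fundamental_theorem_of_calculus)
    fix x :: real assume x: "x \<in> {0..1}"
    then have "0 < x * a + (1 - x) * b" using pos by (intro wharm_denom_pos) auto
    then show "((\<lambda>x. a\<^sup>2 * b * x / (x * a + (1 - x) * b)) has_vector_derivative (wharm x a b)\<^sup>2)
        (at x within {0..1})"
      unfolding has_real_derivative_iff_has_vector_derivative[symmetric] wharm_def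
      by (auto intro!: derivative_eq_intros simp: power2_eq_square divide_simps) algebra
  qed simp
  then show ?thesis using pos by (simp add: power2_eq_square)
qed auto

lemma pair_cost_0 [simp]: "pair_cost 0 b = 0" "pair_cost a 0 = 0"
  by (simp_all add: pair_cost_def)

lemma pair_cost_eq_edge_rate:
  assumes "0 \<le> a" "0 \<le> b"
  shows "pair_cost a b = edge_rate a b"
proof -
  consider "a = 0 \<or> b = 0" | "0 < a" "a = b" | "0 < a" "0 < b" "a \<noteq> b" using assms by fastforce
  then show ?thesis
  proof cases
    case 1
    then show ?thesis by (auto simp: edge_rate_def)
  next
    case 2
    have "x * b + (1 - x) * b = b" for x by (simp add: algebra_simps)
    then have "wharm x b b = b" for x using 2 by (simp add: wharm_def)
    then show ?thesis using 2 by (simp add: pair_cost_def edge_rate_def)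
  next
    case 3
    define F where "F = (\<lambda>x. 2 * a * b / (a - b) * ln (x * a + (1 - x) * b))"
    have "((\<lambda>x. 2 * wharm x a b) has_integral F 1 - F 0) {0..1}"
    proof (rule fundamental_theorem_of_calculus)
      fix x :: real assume x: "x \<in> {0..1}"
      then have "0 < x * a + (1 - x) * b" using 3 by (intro wharm_denom_pos) auto
      then show "(F has_vector_derivative 2 * wharm x a b) (at x within {0..1})"
        unfolding has_real_derivative_iff_has_vector_derivative[symmetric] wharm_def F_def
        using 3 by (auto intro!: derivative_eq_intros simp: divide_simps)
    qed simp
    moreover have "F 1 - F 0 = edge_rate a b"
      using 3 by (simp add: F_def edge_rate_def ln_div right_diff_distrib diff_divide_distrib)
    ultimately show ?thesis
      using has_integral_pair_cost[OF assms] has_integral_unique by metis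
  qed
qed

lemma pair_cost_mono:
  assumes "0 \<le> a" "a \<le> a'" "0 \<le> b" "b \<le> b'"
  shows "pair_cost a b \<le> pair_cost a' b'"
proof (rule has_integral_le[OF has_integral_pair_cost has_integral_pair_cost])
  fix x :: real assume "x \<in> {0..1}"
  then show "2 * wharm x a b \<le> 2 * wharm x a' b'"
    using wharm_mono_left[of x a a' b] wharm_mono_right[of x a' b b'] assms by auto
qed (use assms in auto)

lemma pair_cost_nonneg: "0 \<le> a \<Longrightarrow> 0 \<le> b \<Longrightarrow> 0 \<le> pair_cost a b"
  using pair_cost_mono[of 0 a 0 b] by simp

lemma pair_cost_scale: "0 \<le> t \<Longrightarrow> pair_cost (t * a) (t * b) = t * pair_cost a b"
proof (cases "t = 0")
  case False
  then show ?thesis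
    by (simp add: pair_cost_def wharm_scale mult.left_commute[of 2])
qed simp

lemma pair_cost_le_sum:
  assumes "0 \<le> a" "0 \<le> b"
  shows "pair_cost a b \<le> a + b"
proof -
  have "((\<lambda>x. 2 * (x * b + (1 - x) * a)) has_integral
      (1\<^sup>2 * b + (2 * 1 - 1\<^sup>2) * a - (0\<^sup>2 * b + (2 * 0 - 0\<^sup>2) * a))) {0..1}"
    by (rule fundamental_theorem_of_calculus)
       (auto intro!: derivative_eq_intros
         simp: has_real_derivative_iff_has_vector_derivative[symmetric] algebra_simps)
  moreover have "2 * wharm x a b \<le> 2 * (x * b + (1 - x) * a)" if "x \<in> {0..1}" for x
    using wharm_le_mean[of x a b] that assms by simp
  ultimately have "pair_cost a b \<le>
      1\<^sup>2 * b + (2 * 1 - 1\<^sup>2) * a - (0\<^sup>2 * b + (2 * 0 - 0\<^sup>2) * a)"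
    by (rule has_integral_le[OF has_integral_pair_cost[OF assms]])
  then show ?thesis by simp
qed

lemma pair_cost_le_sqrt:
  assumes "0 \<le> a" "0 \<le> b"
  shows "pair_cost a b \<le> 2 * sqrt (a * b)"
proof (cases "a = 0 \<or> b = 0")
  case False
  define r where "r = sqrt (a * b)"
  have r: "r > 0" "r * r = a * b" using False assms by (auto simp: r_def)
  have "((\<lambda>x. r + (wharm x a b)\<^sup>2 / r) has_integral r + a * b / r) {0..1}"
    using has_integral_const_real[of r 0 1]
    by (intro has_integral_add has_integral_divide has_integral_wharm_square assms) simp
  moreover have "2 * wharm x a b \<le> r + (wharm x a b)\<^sup>2 / r" for x
    using r(1) sum_squares_bound[of "wharm x a b" r]
    by (simp add: field_simps power2_eq_square)
  ultimately have "pair_cost a b \<le> r + a * b / r"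
    by (intro has_integral_le[OF has_integral_pair_cost[OF assms]]) auto
  also have "a * b / r = r" using r by (simp add: divide_simps)
  finally show ?thesis by (simp add: r_def)
qed auto

lemma has_integral_pair_cost_merge:
  assumes "1 \<le> a" "1 \<le> b"
  shows "((\<lambda>x. (1 - x) * wharm x a b * wharm x (a - 1) b + x * wharm x a b * wharm x a (b - 1))
    has_integral a * (a - 1) / 2 * (pair_cost a b - pair_cost (a - 1) b) +
      b * (b - 1) / 2 * (pair_cost a b - pair_cost a (b - 1))) {0..1}"
proof -
  have half: "r / 2 * (2 * u - 2 * v) = r * (u - v)" for r u v :: real by (simp add: algebra_simps)
  have "((\<lambda>x. a * (a - 1) / 2 * (2 * wharm x a b - 2 * wharm x (a - 1) b) +
         b * (b - 1) / 2 * (2 * wharm x a b - 2 * wharm x a (b - 1)))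
    has_integral a * (a - 1) / 2 * (pair_cost a b - pair_cost (a - 1) b) +
         b * (b - 1) / 2 * (pair_cost a b - pair_cost a (b - 1))) {0..1}"
    using assms
    by (intro has_integral_add has_integral_mult_right has_integral_diff has_integral_pair_cost) auto
  then show ?thesis
    by (rule has_integral_eq[rotated])
       (use wharm_step[of _ a b] wharm_step[of "1 - _" b a] assms in
         \<open>simp only: half, simp add: wharm_swap[of _ a b] wharm_swap[of _ a "b - 1"]\<close>)
qed

lemma pair_cost_merge_le:
  assumes "1 \<le> a" "1 \<le> b"
  shows "a * (a - 1) / 2 * (pair_cost a b - pair_cost (a - 1) b) +
         b * (b - 1) / 2 * (pair_cost a b - pair_cost a (b - 1)) \<le> a * b"
proof (rule has_integral_le[OF has_integral_pair_cost_merge[OF assms] has_integral_wharm_square])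
  fix x :: real assume x: "x \<in> {0..1}"
  let ?g = "wharm x a b"
  have "(1 - x) * ?g * wharm x (a - 1) b + x * ?g * wharm x a (b - 1) \<le> (1 - x) * ?g * ?g + x * ?g * ?g"
    using x assms
    by (intro add_mono mult_left_mono wharm_mono_left wharm_mono_right mult_nonneg_nonneg wharm_nonneg) auto
  also have "\<dots> = ?g\<^sup>2" by (simp add: power2_eq_square algebra_simps)
  finally show "(1 - x) * ?g * wharm x (a - 1) b + x * ?g * wharm x a (b - 1) \<le> ?g\<^sup>2" .
qed (use assms in auto)

lemma wharm_gap:
  assumes x: "0 \<le> x" "x \<le> 1" and ab: "1 \<le> a" "1 \<le> b"
  shows "(1 - x) * (wharm x a b - wharm x (a - 1) b) \<le> 1"
proof (cases "a = 1")
  case True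
  then show ?thesis using wharm_bound_left[OF x, of 1 b] ab by simp
next
  case False
  then have a: "0 < a * (a - 1)" using ab by simp
  have "a * (a - 1) * ((1 - x) * (wharm x a b - wharm x (a - 1) b)) =
      (1 - x) * (a * (a - 1) * (wharm x a b - wharm x (a - 1) b))" by simp
  also have "\<dots> = ((1 - x) * wharm x a b) * ((1 - x) * wharm x (a - 1) b)"
    using wharm_step[OF x, of a b] ab by simp
  also have "\<dots> \<le> a * (a - 1)"
    using x ab by (intro mult_mono wharm_bound_left mult_nonneg_nonneg wharm_nonneg) auto
  finally have "a * (a - 1) * ((1 - x) * (wharm x a b - wharm x (a - 1) b)) \<le> a * (a - 1) * 1"
    by simp
  then show ?thesis using a by (rule mult_left_le_imp_le)
qed

lemma pair_cost_merge_ge: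
  assumes "1 \<le> a" "1 \<le> b"
  shows "a * b - pair_cost a b \<le> a * (a - 1) / 2 * (pair_cost a b - pair_cost (a - 1) b) +
         b * (b - 1) / 2 * (pair_cost a b - pair_cost a (b - 1))"
proof (rule has_integral_le[OF _ has_integral_pair_cost_merge[OF assms]])
  show "((\<lambda>x. (wharm x a b)\<^sup>2 - 2 * wharm x a b) has_integral a * b - pair_cost a b) {0..1}"
    using assms by (intro has_integral_diff has_integral_wharm_square has_integral_pair_cost) auto
next
  fix x :: real assume x: "x \<in> {0..1}"
  let ?g = "wharm x a b"
  have "?g * ((1 - x) * (?g - wharm x (a - 1) b)) + ?g * (x * (?g - wharm x a (b - 1))) \<le> ?g * 1 + ?g * 1"
    using wharm_gap[of x a b] wharm_gap[of "1 - x" b a] x assms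
    by (intro add_mono mult_left_mono wharm_nonneg)
       (auto simp: wharm_swap[of x a b] wharm_swap[of x a "b - 1"])
  then show "?g\<^sup>2 - 2 * ?g \<le> (1 - x) * ?g * wharm x (a - 1) b + x * ?g * wharm x a (b - 1)"
    by (simp add: power2_eq_square algebra_simps)
qed

lemma pair_cost_perturb:
  assumes "0 < \<alpha>" "0 < \<beta>" "0 \<le> a" "0 \<le> b"
  shows "\<bar>pair_cost a b - pair_cost \<alpha> \<beta>\<bar> \<le> pair_cost \<alpha> \<beta> * (\<bar>a / \<alpha> - 1\<bar> + \<bar>b / \<beta> - 1\<bar>)"
proof -
  define d where "d = \<bar>a / \<alpha> - 1\<bar> + \<bar>b / \<beta> - 1\<bar>"
  let ?p = "pair_cost \<alpha> \<beta>"
  have "a / \<alpha> \<le> 1 + d" "b / \<beta> \<le> 1 + d" "1 - d \<le> a / \<alpha>" "1 - d \<le> b / \<beta>" unfolding d_def by linarith+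
  then have bnds: "a \<le> (1 + d) * \<alpha>" "b \<le> (1 + d) * \<beta>" "(1 - d) * \<alpha> \<le> a" "(1 - d) * \<beta> \<le> b"
    using assms(1,2) by (simp_all only: pos_divide_le_eq pos_le_divide_eq)
  have "pair_cost a b \<le> pair_cost ((1 + d) * \<alpha>) ((1 + d) * \<beta>)"
    using bnds(1,2) assms(3,4) by (intro pair_cost_mono)
  also have "\<dots> = (1 + d) * ?p" by (rule pair_cost_scale) (simp add: d_def)
  finally have upper: "pair_cost a b \<le> (1 + d) * ?p" .
  have "(1 - d) * ?p \<le> pair_cost a b"
  proof (cases "d \<le> 1")
    case True
    have "(1 - d) * ?p = pair_cost ((1 - d) * \<alpha>) ((1 - d) * \<beta>)"
      using True by (intro pair_cost_scale[symmetric]) simp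
    also have "\<dots> \<le> pair_cost a b"
      using bnds(3,4) assms(1,2) True by (intro pair_cost_mono mult_nonneg_nonneg) simp_all
    finally show ?thesis .
  next
    case False
    then have "(1 - d) * ?p \<le> 0"
      using pair_cost_nonneg[of \<alpha> \<beta>] assms by (intro mult_nonpos_nonneg) auto
    then show ?thesis using pair_cost_nonneg[of a b] assms by simp
  qed
  with upper have "\<bar>pair_cost a b - ?p\<bar> \<le> ?p * d" by (simp add: algebra_simps abs_le_iff)
  then show ?thesis by (simp add: d_def)
qed

subsection \<open>Bounds for fixed classes\<close>

lemma harm_merge:
  "real a * (real a - 1) / 2 * (harm (a - 1) - harm (a - 1 - 1)) = (if 2 \<le> a then real a / 2 else 0)"
proof (cases "2 \<le> a")
  case True
  then obtain k where "a = Suc (Suc k)" by (metis add_2_eq_Suc le_Suc_ex)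
  then show ?thesis by (simp add: harm_Suc field_simps)
next
  case False
  then have "a = 0 \<or> a = 1" by auto
  then show ?thesis by auto
qed

lemma random_ac_init_final:
  assumes "(P, N) \<in> set_pmf (random_ac n (\<lambda>x y. c x = c y) {} {})"
  shows "consistent n c P N" "unknown_pairs n P N = {}"
  using random_ac_final[OF _ assms] by (simp_all add: consistent_def)

text \<open>
  The drift of \<open>m + pair_cost a b\<close> exceeds zero by at most \<open>pair_cost a b \<le> a + b\<close>, which the harmonic
  numbers compensate, except for \<open>a = b = 1\<close>, where at most one query is left; the summand \<open>1\<close> pays
  for it.
\<close>

lemma expected_cross_upper:
  fixes n c i j
  defines "a \<equiv> card {x. x < n \<and> c x = i}" and "b \<equiv> card {x. x < n \<and> c x = j}"
  assumes ij: "i \<noteq> j"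
  shows "measure_pmf.expectation (random_ac n (\<lambda>x y. c x = c y) {} {})
      (\<lambda>(P, N). real (card (cross_pairs c i j N)))
    \<le> (if a = 0 \<or> b = 0 then 0 else pair_cost a b + 4 * harm (a - 1) + 4 * harm (b - 1) + 1)"
proof -
  define \<phi> where "\<phi> = (\<lambda>a b. pair_cost (real a) (real b) + 4 * harm (a - 1) + 4 * harm (b - 1))"
  define \<Theta> where "\<Theta> = (\<lambda>a b m. real m +
    (if a = 0 \<or> b = 0 then 0 else \<phi> a b + (if m = 0 then 1 else 0)))"
  let ?R = "random_ac n (\<lambda>x y. c x = c y) {} {}"
  have \<phi>_nonneg: "0 \<le> \<phi> a b" for a b
    unfolding \<phi>_def by (intro add_nonneg_nonneg mult_nonneg_nonneg pair_cost_nonneg harm_nonneg) auto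
  have \<Theta>_ge: "real m \<le> \<Theta> a b m" for a b m using \<phi>_nonneg[of a b] by (simp add: \<Theta>_def)
  have "measure_pmf.expectation ?R (\<lambda>(P, N). real (card (cross_pairs c i j N)))
      \<le> measure_pmf.expectation ?R (\<lambda>(P, N). \<Theta> (card (class_items n c P i))
          (card (class_items n c P j)) (card (cross_pairs c i j N)))"
    by (intro integral_mono integrable_measure_pmf_finite)
       (auto simp: \<Theta>_ge)
  also have "\<dots> \<le> \<Theta> a b 0"
    unfolding a_def b_def
  proof (rule expectation_two_classes_le[OF ij])
    fix a b m u :: nat
    assume u: "u \<le> a * b" "a * b \<le> u + m" "m > 0 \<Longrightarrow> u < a * b"
    show "real a * (real a - 1) / 2 * (\<Theta> (a - 1) b m - \<Theta> a b m) +
      real b * (real b - 1) / 2 * (\<Theta> a (b - 1) m - \<Theta> a b m) +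
      real u * (\<Theta> a b (Suc m) - \<Theta> a b m) \<le> 0"
    proof (cases "a = 0 \<or> b = 0")
      case True
      then show ?thesis using u by (cases "a = 0"; cases "b = 0") (auto simp: \<Theta>_def)
    next
      case False
      then have ab: "1 \<le> a" "1 \<le> b" by auto
      let ?Ca = "real a * (real a - 1) / 2" and ?Cb = "real b * (real b - 1) / 2"
      let ?Da = "pair_cost a b - pair_cost (real a - 1) b" and ?Db = "pair_cost a b - pair_cost a (real b - 1)"
      have lin: "r * (- x - 4 * y) = - (r * x) - 4 * (r * y)" for r x y :: real
        by (simp add: algebra_simps)
      have m1: "?Ca * (\<Theta> (a - 1) b m - \<Theta> a b m) = - (?Ca * ?Da) - (if 2 \<le> a then 2 * real a else 0)"
      proof (cases "a = 1")
        case False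
        then have "\<Theta> (a - 1) b m - \<Theta> a b m = - ?Da - 4 * (harm (a - 1) - harm (a - 1 - 1))"
          using ab by (simp add: \<Theta>_def \<phi>_def of_nat_diff)
        then have "?Ca * (\<Theta> (a - 1) b m - \<Theta> a b m) =
            - (?Ca * ?Da) - 4 * (?Ca * (harm (a - 1) - harm (a - 1 - 1)))"
          by (simp only: lin)
        then show ?thesis unfolding harm_merge by simp
      qed simp
      have m2: "?Cb * (\<Theta> a (b - 1) m - \<Theta> a b m) = - (?Cb * ?Db) - (if 2 \<le> b then 2 * real b else 0)"
      proof (cases "b = 1")
        case False
        then have "\<Theta> a (b - 1) m - \<Theta> a b m = - ?Db - 4 * (harm (b - 1) - harm (b - 1 - 1))"
          using ab by (simp add: \<Theta>_def \<phi>_def of_nat_diff)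
        then have "?Cb * (\<Theta> a (b - 1) m - \<Theta> a b m) =
            - (?Cb * ?Db) - 4 * (?Cb * (harm (b - 1) - harm (b - 1 - 1)))"
          by (simp only: lin)
        then show ?thesis unfolding harm_merge by simp
      qed simp
      have merge: "0 \<le> ?Ca * ?Da" "0 \<le> ?Cb * ?Db" "real a * real b - pair_cost a b \<le> ?Ca * ?Da + ?Cb * ?Db"
        using ab pair_cost_merge_ge[of a b]
        by (auto intro!: mult_nonneg_nonneg pair_cost_mono)
      show ?thesis
      proof (cases "m = 0")
        case True
        then have "\<Theta> a b (Suc m) - \<Theta> a b m = 0" using ab by (simp add: \<Theta>_def)
        then show ?thesis unfolding m1 m2 using merge by simp
      next
        case m: False
        then have \<Theta>: "\<Theta> a b (Suc m) - \<Theta> a b m = 1" using ab by (simp add: \<Theta>_def)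
        have "real u \<le> real a * real b" using u(1) by (metis of_nat_mono of_nat_mult)
        moreover have "pair_cost a b \<le> real a + real b" by (rule pair_cost_le_sum) auto
        moreover have "u = 0" if "a = 1" "b = 1" using that u(3) m by simp
        ultimately show ?thesis unfolding m1 m2 \<Theta> using merge ab
          by (cases "a = 1"; cases "b = 1") auto
      qed
    qed
  qed
  also have "\<Theta> a b 0 = (if a = 0 \<or> b = 0 then 0
      else pair_cost a b + 4 * harm (a - 1) + 4 * harm (b - 1) + 1)"
    by (simp add: \<Theta>_def \<phi>_def)
  finally show ?thesis .
qed

text \<open>
  The submartingale is \<open>m + pair_cost a b\<close>, corrected for the at most \<open>m\<close> cross pairs already known.
  They cost little as long as \<open>a > K\<close>, and what happens later is ignored.
\<close>

lemma expected_cross_lower: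
  fixes n c i j and K :: nat
  defines "a \<equiv> card {x. x < n \<and> c x = i}" and "b \<equiv> card {x. x < n \<and> c x = j}"
  assumes ij: "i \<noteq> j" and K: "1 \<le> K"
  shows "pair_cost a b - b * (4 / K) * harm (a - 1) - 2 * sqrt (K * b)
    \<le> measure_pmf.expectation (random_ac n (\<lambda>x y. c x = c y) {} {})
      (\<lambda>(P, N). real (card (cross_pairs c i j N)))"
proof -
  define L where "L = (\<lambda>a b m. pair_cost (real a) (real b) - real m * (2 * (1 / K - 1 / a))
    - b * (4 / K) * harm (a - 1) - 2 * sqrt (K * b))"
  define \<Theta> where "\<Theta> = (\<lambda>a b m. - (real m + (if a \<le> K then 0 else L a b m)))"
  let ?R = "random_ac n (\<lambda>x y. c x = c y) {} {}"
  have small: "pair_cost a b - b * (4 / K) * harm (a - 1) - 2 * sqrt (K * b) \<le> 0"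
    if "a \<le> K" for a b :: nat
  proof -
    have "pair_cost a b \<le> 2 * sqrt (real a * real b)" by (rule pair_cost_le_sqrt) auto
    also have "\<dots> \<le> 2 * sqrt (K * b)" using that by (auto intro: mult_right_mono)
    finally show ?thesis
      using mult_nonneg_nonneg[OF mult_nonneg_nonneg[of "real b" "4 / K"] harm_nonneg[of "a - 1"]] by simp
  qed
  have "measure_pmf.expectation ?R (\<lambda>(P, N). - real (card (cross_pairs c i j N)))
      = measure_pmf.expectation ?R (\<lambda>(P, N). \<Theta> (card (class_items n c P i))
          (card (class_items n c P j)) (card (cross_pairs c i j N)))"
  proof (intro integral_cong_AE, simp, simp, rule AE_pmfI, clarify)
    fix P N assume "(P, N) \<in> set_pmf ?R"
    from random_ac_init_final[OF this]
    have "real (card (class_items n c P i)) * (real (card (class_items n c P i)) - 1) = 0"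
      using card_inner_unknown[of n c P N i] by (simp add: inner_pairs_def)
    then have "card (class_items n c P i) \<le> K" using K by auto
    then show "- real (card (cross_pairs c i j N)) = \<Theta> (card (class_items n c P i))
          (card (class_items n c P j)) (card (cross_pairs c i j N))"
      by (simp add: \<Theta>_def)
  qed
  also have "\<dots> \<le> \<Theta> a b 0"
    unfolding a_def b_def
  proof (rule expectation_two_classes_le[OF ij])
    fix a b m u :: nat
    assume u: "u \<le> a * b" "a * b \<le> u + m"
    have "real u \<le> real a * real b" "real a * real b \<le> real u + real m"
      using u by (metis of_nat_mono of_nat_mult of_nat_add)+
    note ru = this
    show "real a * (real a - 1) / 2 * (\<Theta> (a - 1) b m - \<Theta> a b m) +
      real b * (real b - 1) / 2 * (\<Theta> a (b - 1) m - \<Theta> a b m) +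
      real u * (\<Theta> a b (Suc m) - \<Theta> a b m) \<le> 0"
    proof (cases "a \<le> K")
      case True
      then have "a - 1 \<le> K" by simp
      with True show ?thesis by (simp add: \<Theta>_def)
    next
      case False
      then have a: "2 \<le> a" "K < a" using K by auto
      let ?Ca = "real a * (real a - 1) / 2" and ?Cb = "real b * (real b - 1) / 2"
      let ?Da = "pair_cost a b - pair_cost (real a - 1) b" and ?Db = "pair_cost a b - pair_cost a (real b - 1)"
      let ?w = "2 * (1 / K - 1 / a)"
      have w: "0 \<le> ?w" "?w \<le> 2 / K" using a K by (auto simp: field_simps)
      have Lm: "L a b (Suc m) - L a b m = - ?w" by (simp add: L_def algebra_simps add_divide_distrib)
      have La: "L (a - 1) b m \<le> - \<Theta> (a - 1) b m - m"
      proof (cases "a - 1 \<le> K")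
        case True
        then have "a - 1 = K" using a by simp
        then show ?thesis using small[of "a - 1" b] by (simp add: L_def \<Theta>_def)
      qed (simp add: \<Theta>_def)
      have "L (a - 1) b m - L a b m = - ?Da + m * (2 * (1 / (real a - 1) - 1 / a))
          + b * (4 / K) * (harm (a - 1) - harm (a - 1 - 1))"
        using a by (simp add: L_def of_nat_diff algebra_simps)
      then have "?Ca * (L (a - 1) b m - L a b m) = - (?Ca * ?Da)
          + m * (?Ca * (2 * (1 / (real a - 1) - 1 / a)))
          + b * (4 / K) * (?Ca * (harm (a - 1) - harm (a - 1 - 1)))"
        by (simp only: distrib_left mult.left_commute minus_mult_right)
      also have "?Ca * (2 * (1 / (real a - 1) - 1 / a)) = 1"
        using a by (simp add: divide_simps)
      also have "?Ca * (harm (a - 1) - harm (a - 1 - 1)) = a / 2"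
        unfolding harm_merge using a by simp
      finally have m1: "?Ca * (L (a - 1) b m - L a b m) = - (?Ca * ?Da) + m + real a * real b * (2 / K)"
        by simp
      have "?Ca * (L (a - 1) b m - L a b m) \<le> ?Ca * (\<Theta> a b m - \<Theta> (a - 1) b m)"
        using a La by (intro mult_left_mono) (auto simp: \<Theta>_def)
      moreover have "- (?Cb * ?Db) \<le> ?Cb * (\<Theta> a b m - \<Theta> a (b - 1) m)"
      proof (cases "b = 0")
        case False
        have "sqrt (K * (b - 1)) \<le> sqrt (K * b)" by (intro real_sqrt_le_mono of_nat_mono) simp
        moreover have "(real b - 1) * (4 / K) * harm (a - 1) \<le> b * (4 / K) * harm (a - 1)"
          using harm_nonneg[of "a - 1"] by (intro mult_right_mono) auto
        moreover have "real (b - 1) = real b - 1" using False by simp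
        ultimately have "- ?Db \<le> L a (b - 1) m - L a b m"
          unfolding L_def by (simp only:)
        then have "?Cb * (- ?Db) \<le> ?Cb * (L a (b - 1) m - L a b m)"
          using False by (intro mult_left_mono) auto
        moreover have "\<Theta> a b m - \<Theta> a (b - 1) m = L a (b - 1) m - L a b m"
          using a by (simp add: \<Theta>_def)
        ultimately show ?thesis by (simp only: mult_minus_right)
      qed simp
      moreover have "?Ca * ?Da + ?Cb * ?Db \<le> real a * real b"
        using pair_cost_merge_le[of a b] a by (cases "b = 0") auto
      moreover have "real u - real a * real b * (2 / K) \<le> real u * (\<Theta> a b m - \<Theta> a b (Suc m))"
      proof -
        have "real u * ?w \<le> real a * real b * (2 / K)" using ru w by (intro mult_mono) auto
        moreover have "\<Theta> a b m - \<Theta> a b (Suc m) = 1 - ?w" using a Lm by (simp add: \<Theta>_def)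
        ultimately show ?thesis by (simp only: right_diff_distrib)
      qed
      ultimately show ?thesis using m1 ru(2) by (simp only: right_diff_distrib)
    qed
  qed
  finally have "- \<Theta> a b 0 \<le> measure_pmf.expectation ?R (\<lambda>(P, N). real (card (cross_pairs c i j N)))"
    by (simp add: case_prod_unfold)
  moreover have "pair_cost a b - b * (4 / K) * harm (a - 1) - 2 * sqrt (K * b) \<le> - \<Theta> a b 0"
    using small[of a b] by (simp add: \<Theta>_def L_def)
  ultimately show ?thesis by (rule order_trans[rotated])
qed

subsection \<open>Random classes\<close>

lemma map_pmf_eq_bernoulli: "map_pmf (\<lambda>y. y = i) q = bernoulli_pmf (pmf q i)"
proof (rule pmf_eqI)
  fix b
  have p: "0 \<le> pmf q i" "pmf q i \<le> 1" by (simp_all add: pmf_le_1)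
  have T: "pmf (map_pmf (\<lambda>y. y = i) q) True = pmf q i"
    by (simp add: pmf_map vimage_def measure_pmf_single)
  have "(\<Sum>b\<in>UNIV. pmf (map_pmf (\<lambda>y. y = i) q) b) = 1" by (rule sum_pmf_eq_1) auto
  then have "pmf (map_pmf (\<lambda>y. y = i) q) True + pmf (map_pmf (\<lambda>y. y = i) q) False = 1"
    by (simp add: UNIV_bool add.commute)
  then show "pmf (map_pmf (\<lambda>y. y = i) q) b = pmf (bernoulli_pmf (pmf q i)) b"
    using T p by (cases b) auto
qed

lemma map_pmf_count_Pi_pmf:
  assumes "finite A" "d \<noteq> i"
  shows "map_pmf (\<lambda>c. card {x \<in> A. c x = i}) (Pi_pmf A d (\<lambda>_. q)) = binomial_pmf (card A) (pmf q i)"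
proof -
  have "binomial_pmf (card A) (pmf q i) = map_pmf (\<lambda>f. card {x \<in> A. f x})
      (Pi_pmf A False (\<lambda>_. map_pmf (\<lambda>y. y = i) q))"
    unfolding map_pmf_eq_bernoulli using assms
    by (intro binomial_pmf_altdef') (auto simp: pmf_le_1)
  also have "Pi_pmf A False (\<lambda>_. map_pmf (\<lambda>y. y = i) q) = map_pmf (\<lambda>h. (\<lambda>y. y = i) \<circ> h) (Pi_pmf A d (\<lambda>_. q))"
    using assms by (intro Pi_pmf_map) auto
  finally show ?thesis by (simp add: map_pmf_comp)
qed

lemma binomial_second_moment:
  assumes "p \<in> {0..1}"
  shows "measure_pmf.expectation (binomial_pmf n p) (\<lambda>k. (real k - n * p)\<^sup>2) = n * p * (1 - p)"
proof -
  have "measure_pmf.expectation (binomial_pmf n p) (\<lambda>k. (real k - n * p)\<^sup>2)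
      = (\<Sum>k\<le>n. Bernstein n k p * (real k - n * p)\<^sup>2)"
    using assms by (simp add: expectation_binomial_pmf' Bernstein_def)
  also have "\<dots> = (\<Sum>k\<le>n. real k * (real k - 1) * Bernstein n k p
      + (1 - 2 * (n * p)) * (real k * Bernstein n k p) + (n * p)\<^sup>2 * Bernstein n k p)"
    by (intro sum.cong) (auto simp: power2_eq_square algebra_simps)
  also have "\<dots> = n * p * (1 - p)"
    by (simp only: sum.distrib sum_distrib_left[symmetric] sum_Bernstein sum_k_Bernstein sum_kk_Bernstein)
       (simp add: power2_eq_square algebra_simps)
  finally show ?thesis .
qed

lemma binomial_absolute_deviation:
  assumes p: "p \<in> {0..1}"
  shows "measure_pmf.expectation (binomial_pmf n p) (\<lambda>k. \<bar>real k - n * p\<bar>) \<le> sqrt n"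
proof (rule real_le_rsqrt)
  have "(measure_pmf.expectation (binomial_pmf n p) (\<lambda>k. \<bar>real k - n * p\<bar>))\<^sup>2
      \<le> measure_pmf.expectation (binomial_pmf n p) (\<lambda>k. \<bar>real k - n * p\<bar>\<^sup>2)"
    using measure_pmf.variance_positive[of "binomial_pmf n p" "\<lambda>k. \<bar>real k - n * p\<bar>"]
      measure_pmf.variance_eq[of "binomial_pmf n p" "\<lambda>k. \<bar>real k - n * p\<bar>",
        OF integrable_binomial_pmf[OF p] integrable_binomial_pmf[OF p]] by simp
  also have "\<dots> = n * (p * (1 - p))" using binomial_second_moment[OF p] by simp
  also have "\<dots> \<le> real n * 1" using p by (intro mult_left_mono mult_le_one) auto
  finally show "(measure_pmf.expectation (binomial_pmf n p) (\<lambda>k. \<bar>real k - n * p\<bar>))\<^sup>2 \<le> n" by simp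
qed

lemma harm_le_1_ln:
  assumes "1 \<le> n" shows "harm n \<le> 1 + ln (real n)"
proof -
  obtain m where "n = Suc m" using assms by (cases n) auto
  then show ?thesis
    using decseqD[OF decseq_harm_diff_ln, of 0 m] by (simp add: harm_Suc harm_expand)
qed

lemma card_negative_answers:
  assumes "consistent n c P N" and c: "\<And>x. x < n \<Longrightarrow> c x \<in> {1..k}"
  shows "card N = (\<Sum>(i, j) | 1 \<le> i \<and> i < j \<and> j \<le> k. card (cross_pairs c i j N))"
proof -
  define S where "S = {(i, j). 1 \<le> i \<and> i < j \<and> j \<le> k}"
  let ?g = "\<lambda>(x, y). (min (c x) (c y), max (c x) (c y))"
  have fin: "finite S" unfolding S_def by (rule finite_subset[of _ "{..k} \<times> {..k}"]) auto
  have N: "N \<subseteq> {(x, y). x < n \<and> y < n \<and> c x \<noteq> c y}" using assms(1) by (simp add: consistent_def)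
  have im: "?g ` N \<subseteq> S"
  proof clarify
    fix x y assume "(x, y) \<in> N"
    then have "x < n" "y < n" "c x \<noteq> c y" using N by auto
    then show "(min (c x) (c y), max (c x) (c y)) \<in> S"
      using c[of x] c[of y] by (auto simp: S_def min_def max_def)
  qed
  have "card N = (\<Sum>s\<in>S. card {e \<in> N. ?g e = s})"
    using sum.group[OF consistent_finite[OF assms(1)] fin im, of "\<lambda>_. 1 :: nat"] by simp
  also have "\<dots> = (\<Sum>(i, j)\<in>S. card (cross_pairs c i j N))"
  proof (rule sum.cong, simp, clarify)
    fix i j assume "(i, j) \<in> S"
    then have "i < j" by (simp add: S_def)
    then have "(min a b = i \<and> max a b = j) = ({a, b} = {i, j})" for a b
      by (cases "a \<le> b") (auto simp: doubleton_eq_iff)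
    then have "{e \<in> N. ?g e = (i, j)} = cross_pairs c i j N"
      by (auto simp: cross_pairs_def)
    then show "card {e \<in> N. ?g e = (i, j)} = card (cross_pairs c i j N)" by simp
  qed
  finally show ?thesis by (simp add: S_def)
qed

definition expected_cross :: "nat \<Rightarrow> nat \<Rightarrow> nat \<Rightarrow> (nat \<Rightarrow> nat) \<Rightarrow> real" where
  "expected_cross n i j c = measure_pmf.expectation (random_ac n (\<lambda>x y. c x = c y) {} {})
      (\<lambda>(P, N). real (card (cross_pairs c i j N)))"

text \<open>
  The third term comes from queries between two items that are already compared, the fourth from
  the end of the process; taking \<open>K\<close> near \<open>sqrt n\<close> keeps both below linear order.
\<close>

definition cost_error :: "nat \<Rightarrow> real" where
  "cost_error n = (let K = nat \<lceil>sqrt n\<rceil> in 8 * harm n + 1 + n * (4 / K) * harm n + 2 * sqrt (K * n))"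

lemma cost_error_sublinear: "(\<lambda>n. cost_error n / n) \<longlonglongrightarrow> 0"
proof (rule tendsto_sandwich[OF _ _ tendsto_const])
  let ?u = "\<lambda>n::nat. (8 * (1 + ln n) + 1 + n * (4 / sqrt n) * (1 + ln n) + 2 * sqrt ((sqrt n + 1) * n)) / n"
  show "?u \<longlonglongrightarrow> 0" by real_asymp
  show "\<forall>\<^sub>F n in sequentially. 0 \<le> cost_error n / n"
    by (intro always_eventually allI)
       (unfold cost_error_def Let_def, intro divide_nonneg_nonneg add_nonneg_nonneg mult_nonneg_nonneg
         harm_nonneg real_sqrt_ge_zero of_nat_0_le_iff zero_le_numeral zero_le_one)
  show "\<forall>\<^sub>F n in sequentially. cost_error n / n \<le> ?u n"
  proof (intro eventually_sequentiallyI[of 1] divide_right_mono)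
    fix n :: nat assume n: "1 \<le> n"
    define K where "K = nat \<lceil>sqrt n\<rceil>"
    have "0 \<le> sqrt n" by simp
    then have "real K = of_int \<lceil>sqrt n\<rceil>" unfolding K_def by (intro of_nat_nat) linarith
    then have K: "sqrt n \<le> K" "K \<le> sqrt n + 1" by linarith+
    have "0 < sqrt n" using n by simp
    then have "0 < real K" using K(1) by (rule less_le_trans)
    have h: "harm n \<le> 1 + ln (real n)" using n by (rule harm_le_1_ln)
    have "n * (4 / K) * harm n \<le> n * (4 / sqrt n) * (1 + ln n)"
      using n K(1) \<open>0 < real K\<close> h harm_nonneg[of n, where 'a = real]
      by (intro mult_mono mult_left_mono divide_left_mono mult_pos_pos mult_nonneg_nonneg)
         auto
    moreover have "sqrt (K * n) \<le> sqrt ((sqrt n + 1) * n)"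
      using K(2) by (intro real_sqrt_le_mono) (simp add: mult_right_mono)
    ultimately show "cost_error n \<le> 8 * (1 + ln n) + 1 + n * (4 / sqrt n) * (1 + ln n) + 2 * sqrt ((sqrt n + 1) * n)"
      using h unfolding cost_error_def Let_def K_def[symmetric] by (intro add_mono) simp_all
  qed simp
qed

lemma expected_cross_nonneg: "0 \<le> expected_cross n i j c"
  unfolding expected_cross_def by (rule Bochner_Integration.integral_nonneg) auto

lemma expected_cross_eq_0:
  assumes "i \<noteq> j" "card {x. x < n \<and> c x = i} = 0 \<or> card {x. x < n \<and> c x = j} = 0"
  shows "expected_cross n i j c = 0"
proof (rule order_antisym)
  show "expected_cross n i j c \<le> 0"
    using expected_cross_upper[OF assms(1), of n c]
    unfolding expected_cross_def[symmetric] by (simp only: assms(2) if_True)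
qed (rule expected_cross_nonneg)

lemma expected_cross_approx:
  fixes n c i j
  defines "a \<equiv> card {x. x < n \<and> c x = i}" and "b \<equiv> card {x. x < n \<and> c x = j}"
  assumes ij: "i \<noteq> j" and pq: "0 < p" "0 < q" and n: "1 \<le> n"
  shows "\<bar>expected_cross n i j c - n * pair_cost p q\<bar>
    \<le> pair_cost p q * (\<bar>a - n * p\<bar> / p + \<bar>b - n * q\<bar> / q) + cost_error n"
proof -
  define K where "K = nat \<lceil>sqrt n\<rceil>"
  have "sqrt n > 0" using n by simp
  then have K: "1 \<le> K" unfolding K_def by linarith
  have "a \<le> card {..<n}" "b \<le> card {..<n}" unfolding a_def b_def by (intro card_mono; auto)+
  then have le: "a \<le> n" "b \<le> n" by auto
  have harm: "harm (a - 1) \<le> (harm n :: real)" "harm (b - 1) \<le> (harm n :: real)"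
    using le by (auto intro!: harm_mono)
  have nn: "0 \<le> n * (4 / K) * (harm n :: real)" "0 \<le> (harm n :: real)" "0 \<le> sqrt (K * n)"
    using harm_nonneg[of n, where 'a = real] by simp_all
  have e: "cost_error n = 8 * harm n + 1 + n * (4 / K) * harm n + 2 * sqrt (K * n)"
    by (simp add: cost_error_def K_def Let_def)
  have "expected_cross n i j c \<le> pair_cost a b + 8 * harm n + 1"
    using expected_cross_upper[OF ij, of n c] harm nn(2) pair_cost_nonneg[of a b]
    unfolding expected_cross_def[symmetric] a_def[symmetric] b_def[symmetric]
    by (auto split: if_splits)
  moreover have "pair_cost a b - n * (4 / K) * harm n - 2 * sqrt (K * n) \<le> expected_cross n i j c"
  proof -
    have "b * (4 / K) * harm (a - 1) \<le> n * (4 / K) * harm n"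
      using le harm harm_nonneg[of "a - 1"] by (intro mult_mono) auto
    moreover have "sqrt (K * b) \<le> sqrt (K * n)" using le by (simp add: mult_left_mono)
    moreover have "pair_cost a b - b * (4 / K) * harm (a - 1) - 2 * sqrt (K * b) \<le> expected_cross n i j c"
      using expected_cross_lower[OF ij K, of n c]
      unfolding expected_cross_def[symmetric] a_def[symmetric] b_def[symmetric] .
    ultimately show ?thesis by linarith
  qed
  ultimately have "\<bar>expected_cross n i j c - pair_cost a b\<bar> \<le> cost_error n"
    unfolding e using nn by linarith
  moreover have "\<bar>pair_cost a b - n * pair_cost p q\<bar>
      \<le> pair_cost p q * (\<bar>a - n * p\<bar> / p + \<bar>b - n * q\<bar> / q)"
  proof -
    have scale: "n * \<bar>z / (n * r) - 1\<bar> = \<bar>z - n * r\<bar> / r" if "0 < r" for z r :: real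
    proof -
      have "z / (n * r) - 1 = (z - n * r) / (n * r)" using n that by (simp add: diff_divide_distrib)
      then show ?thesis using n that by (simp add: abs_mult)
    qed
    have "\<bar>pair_cost a b - pair_cost (n * p) (n * q)\<bar>
        \<le> pair_cost (n * p) (n * q) * (\<bar>a / (n * p) - 1\<bar> + \<bar>b / (n * q) - 1\<bar>)"
      using n pq by (intro pair_cost_perturb) auto
    also have "pair_cost (n * p) (n * q) = n * pair_cost p q" by (rule pair_cost_scale) simp
    also have "n * pair_cost p q * (\<bar>a / (n * p) - 1\<bar> + \<bar>b / (n * q) - 1\<bar>)
        = pair_cost p q * (n * \<bar>a / (n * p) - 1\<bar> + n * \<bar>b / (n * q) - 1\<bar>)"
      by (simp add: algebra_simps)
    finally show ?thesis unfolding scale[OF pq(1)] scale[OF pq(2)] .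
  qed
  ultimately show ?thesis by linarith
qed

context
  fixes k :: nat and p :: "nat \<Rightarrow> real"
  assumes p_nonneg: "\<And>i. i \<in> {1..k} \<Longrightarrow> 0 \<le> p i" and p_sum: "(\<Sum>i=1..k. p i) = 1"
begin

lemma pmf_class: "pmf (class_pmf k p) i = (if i \<in> {1..k} then p i else 0)"
  using p_nonneg p_sum by (rule pmf_class_pmf)

lemma set_class_pmf: "set_pmf (class_pmf k p) = {i \<in> {1..k}. p i \<noteq> 0}"
  by (auto simp: set_pmf_eq pmf_class)

lemma set_random_classes: "set_pmf (random_classes n k p) = PiE_dflt {..<n} 0 (\<lambda>_. {i \<in> {1..k}. p i \<noteq> 0})"
  unfolding random_classes_def by (simp add: set_Pi_pmf set_class_pmf comp_def)

lemma finite_random_classes [simp]: "finite (set_pmf (random_classes n k p))"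
  unfolding set_random_classes by (intro finite_PiE_dflt) auto

lemma integrable_random_classes [simp]: "integrable (measure_pmf (random_classes n k p)) (f :: _ \<Rightarrow> real)"
  by (rule integrable_measure_pmf_finite) simp

lemma p_range: "i \<in> {1..k} \<Longrightarrow> p i \<in> {0..1}"
  using p_nonneg p_sum member_le_sum[of i "{1..k}" p] by auto

lemma class_size_deviation:
  assumes i: "i \<in> {1..k}"
  shows "measure_pmf.expectation (random_classes n k p)
      (\<lambda>c. \<bar>real (card {x. x < n \<and> c x = i}) - n * p i\<bar>) \<le> sqrt n"
proof -
  have "map_pmf (\<lambda>c. card {x \<in> {..<n}. c x = i}) (random_classes n k p) = binomial_pmf n (p i)"
    unfolding random_classes_def using i
    by (subst map_pmf_count_Pi_pmf) (auto simp: pmf_class)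
  then have "measure_pmf.expectation (random_classes n k p)
      (\<lambda>c. \<bar>real (card {x. x < n \<and> c x = i}) - n * p i\<bar>)
    = measure_pmf.expectation (binomial_pmf n (p i)) (\<lambda>l. \<bar>real l - n * p i\<bar>)"
    by (simp flip: \<open>_ = binomial_pmf n (p i)\<close>)
  then show ?thesis using binomial_absolute_deviation[OF p_range[OF i]] by simp
qed

lemma expectation_inter_class_queries:
  "measure_pmf.expectation (inter_class_queries n k p) real =
    (\<Sum>(i, j) | 1 \<le> i \<and> i < j \<and> j \<le> k.
       measure_pmf.expectation (random_classes n k p) (expected_cross n i j))"
proof -
  let ?S = "{(i, j). 1 \<le> i \<and> i < j \<and> j \<le> k}"
  let ?R = "\<lambda>c. random_ac n (\<lambda>x y. c x = c y) {} {}"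
  let ?D = "random_classes n k p"
  have "measure_pmf.expectation (inter_class_queries n k p) real =
      (\<Sum>c\<in>set_pmf ?D. pmf ?D c * measure_pmf.expectation (?R c) (\<lambda>(P, N). real (card N)))"
    unfolding inter_class_queries_def
    by (subst pmf_expectation_bind[of "set_pmf ?D"]) (auto simp: case_prod_unfold)
  also have "\<dots> = measure_pmf.expectation ?D (\<lambda>c. measure_pmf.expectation (?R c) (\<lambda>(P, N). real (card N)))"
    by (subst integral_measure_pmf[of "set_pmf ?D"]) auto
  also have "\<dots> = measure_pmf.expectation ?D (\<lambda>c. \<Sum>(i, j)\<in>?S. expected_cross n i j c)"
  proof (intro integral_cong_AE, simp, simp, rule AE_pmfI)
    fix c assume "c \<in> set_pmf ?D"
    then have c: "\<And>x. x < n \<Longrightarrow> c x \<in> {1..k}" by (auto simp: set_random_classes PiE_dflt_def)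
    have "measure_pmf.expectation (?R c) (\<lambda>(P, N). real (card N))
        = measure_pmf.expectation (?R c) (\<lambda>PN. \<Sum>(i, j)\<in>?S. case PN of (P, N) \<Rightarrow> real (card (cross_pairs c i j N)))"
    proof (intro integral_cong_AE, simp, simp, rule AE_pmfI, clarify)
      fix P N assume "(P, N) \<in> set_pmf (?R c)"
      from card_negative_answers[OF random_ac_init_final(1)[OF this] c]
      show "real (card N) = (\<Sum>(i, j)\<in>?S. real (card (cross_pairs c i j N)))"
        by (simp add: case_prod_unfold)
    qed
    also have "\<dots> = (\<Sum>(i, j)\<in>?S. expected_cross n i j c)"
      unfolding expected_cross_def case_prod_unfold
      by (rule Bochner_Integration.integral_sum) (auto intro!: integrable_measure_pmf_finite)
    finally show "measure_pmf.expectation (?R c) (\<lambda>(P, N). real (card N)) = (\<Sum>(i, j)\<in>?S. expected_cross n i j c)" .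
  qed
  also have "\<dots> = (\<Sum>(i, j)\<in>?S. measure_pmf.expectation ?D (expected_cross n i j))"
    unfolding case_prod_unfold by (rule Bochner_Integration.integral_sum) simp
  finally show ?thesis .
qed

lemma expected_cross_null:
  assumes ij: "i \<in> {1..k}" "j \<in> {1..k}" "i \<noteq> j" and "p i = 0 \<or> p j = 0"
  shows "measure_pmf.expectation (random_classes n k p) (expected_cross n i j) = 0"
proof -
  have "measure_pmf.expectation (random_classes n k p) (expected_cross n i j)
      = measure_pmf.expectation (random_classes n k p) (\<lambda>_. 0)"
  proof (intro integral_cong_AE, simp, simp, rule AE_pmfI)
    fix c assume "c \<in> set_pmf (random_classes n k p)"
    then have "\<And>x. x < n \<Longrightarrow> p (c x) \<noteq> 0" by (auto simp: set_random_classes PiE_dflt_def)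
    then have "{x. x < n \<and> c x = i} = {} \<or> {x. x < n \<and> c x = j} = {}" using assms(4) by blast
    then show "expected_cross n i j c = 0" using ij(3) by (intro expected_cross_eq_0) auto
  qed
  then show ?thesis by simp
qed

lemma expected_cross_limit:
  assumes ij: "i \<in> {1..k}" "j \<in> {1..k}" "i \<noteq> j"
  shows "(\<lambda>n. measure_pmf.expectation (random_classes n k p) (expected_cross n i j) / n)
    \<longlonglongrightarrow> edge_rate (p i) (p j)"
proof (cases "p i = 0 \<or> p j = 0")
  case True
  then have "edge_rate (p i) (p j) = 0" by (auto simp: edge_rate_def)
  then show ?thesis using True by (simp add: expected_cross_null[OF ij])
next
  case False
  then have pos: "0 < p i" "0 < p j" using p_nonneg ij by force+
  let ?J = "pair_cost (p i) (p j)"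
  let ?E = "\<lambda>n. measure_pmf.expectation (random_classes n k p)"
  have J: "0 \<le> ?J" using pos by (intro pair_cost_nonneg) auto
  have main: "\<bar>?E n (expected_cross n i j) / n - ?J\<bar>
      \<le> ?J * (sqrt n / p i + sqrt n / p j) / n + cost_error n / n" if n: "1 \<le> n" for n
  proof -
    let ?a = "\<lambda>i c. real (card {x. x < n \<and> c x = i})"
    have "\<bar>?E n (expected_cross n i j) - n * ?J\<bar> = \<bar>?E n (\<lambda>c. expected_cross n i j c - n * ?J)\<bar>"
      by simp
    also have "\<dots> \<le> ?E n (\<lambda>c. \<bar>expected_cross n i j c - n * ?J\<bar>)" by (rule integral_abs_bound)
    also have "\<dots> \<le> ?E n (\<lambda>c. ?J * (\<bar>?a i c - n * p i\<bar> / p i + \<bar>?a j c - n * p j\<bar> / p j) + cost_error n)"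
      using expected_cross_approx[OF ij(3) pos n] by (intro integral_mono) auto
    also have "\<dots> = ?J * (?E n (\<lambda>c. \<bar>?a i c - n * p i\<bar>) / p i + ?E n (\<lambda>c. \<bar>?a j c - n * p j\<bar>) / p j) + cost_error n"
      by simp
    also have "\<dots> \<le> ?J * (sqrt n / p i + sqrt n / p j) + cost_error n"
      using pos J class_size_deviation[OF ij(1)] class_size_deviation[OF ij(2)]
      by (intro add_mono mult_left_mono divide_right_mono order_refl) auto
    finally have "\<bar>?E n (expected_cross n i j) - n * ?J\<bar> / n \<le> (?J * (sqrt n / p i + sqrt n / p j) + cost_error n) / n"
      by (rule divide_right_mono) simp
    moreover have "?E n (expected_cross n i j) / n - ?J = (?E n (expected_cross n i j) - n * ?J) / n"
      using n by (simp add: diff_divide_distrib)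
    ultimately show ?thesis by (simp add: add_divide_distrib)
  qed
  have "(\<lambda>n. ?J * (sqrt n / p i + sqrt n / p j) / n) \<longlonglongrightarrow> 0" using pos by real_asymp
  then have lim: "(\<lambda>n. ?J * (sqrt n / p i + sqrt n / p j) / n + cost_error n / n) \<longlonglongrightarrow> 0"
    using tendsto_add[OF _ cost_error_sublinear] by fastforce
  have "(\<lambda>n. ?E n (expected_cross n i j) / n - ?J) \<longlonglongrightarrow> 0"
    by (rule Lim_null_comparison[OF _ lim]) (use main in \<open>auto intro!: eventually_sequentiallyI[of 1]\<close>)
  then show ?thesis using pos by (simp add: LIM_zero_iff pair_cost_eq_edge_rate)
qed

end

lemma edge_rate_pos:
  assumes "0 < a" "0 < b" shows "0 < edge_rate a b"
proof -
  have "0 < edge_rate (min a b) (min a b)" using assms by (simp add: edge_rate_def)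
  also have "\<dots> = pair_cost (min a b) (min a b)" using assms by (simp add: pair_cost_eq_edge_rate)
  also have "\<dots> \<le> pair_cost a b" using assms by (intro pair_cost_mono) auto
  finally show ?thesis using assms by (simp add: pair_cost_eq_edge_rate)
qed

theorem theorem7:
  fixes k :: nat and p :: "nat \<Rightarrow> real"
  assumes "\<And>i. i \<in> {1..k} \<Longrightarrow> 0 \<le> p i"
    and "\<And>i j. 1 \<le> i \<Longrightarrow> i \<le> j \<Longrightarrow> j \<le> k \<Longrightarrow> p j \<le> p i"
    and "(\<Sum>i=1..k. p i) = 1"
  shows "(\<lambda>n. measure_pmf.expectation (inter_class_queries n k p) real)
           \<sim>[sequentially] (\<lambda>n. (\<Sum>(i, j) | 1 \<le> i \<and> i < j \<and> j \<le> k. edge_rate (p i) (p j)) * real n)"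
proof -
  let ?S = "{(i, j). 1 \<le> i \<and> i < j \<and> j \<le> k}"
  let ?Q = "\<lambda>n i j. measure_pmf.expectation (random_classes n k p) (expected_cross n i j)"
  let ?r = "\<Sum>(i, j)\<in>?S. edge_rate (p i) (p j)"
  have fin: "finite ?S" by (rule finite_subset[of _ "{..k} \<times> {..k}"]) auto
  have EX: "measure_pmf.expectation (inter_class_queries n k p) real = (\<Sum>(i, j)\<in>?S. ?Q n i j)" for n
    using assms(1,3) by (rule expectation_inter_class_queries)
  show ?thesis
  proof (cases "\<exists>(i, j)\<in>?S. 0 < p i \<and> 0 < p j")
    case True
    then obtain i j where ij: "(i, j) \<in> ?S" "0 < p i" "0 < p j" by auto
    have "0 \<le> edge_rate (p i) (p j)" if "(i, j) \<in> ?S" for i j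
      using that assms(1)[of i] assms(1)[of j] pair_cost_nonneg[of "p i" "p j"]
      by (auto simp: pair_cost_eq_edge_rate)
    then have r: "0 < ?r"
      using ij edge_rate_pos[OF ij(2,3)] by (intro sum_pos2[OF fin ij(1)]) auto
    have "(\<lambda>n. \<Sum>(i, j)\<in>?S. ?Q n i j / n) \<longlonglongrightarrow> ?r"
      unfolding case_prod_unfold
      by (rule tendsto_sum) (auto intro!: expected_cross_limit[OF assms(1,3)])
    from tendsto_divide[OF this tendsto_const[of ?r]]
    have "(\<lambda>n. (\<Sum>(i, j)\<in>?S. ?Q n i j / n) / ?r) \<longlonglongrightarrow> 1" using r by simp
    then show ?thesis
      by (intro asymp_equivI') (simp add: EX sum_divide_distrib case_prod_unfold mult.commute)
  next
    case False
    have null: "p i = 0 \<or> p j = 0" if "(i, j) \<in> ?S" for i j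
    proof -
      have "\<not> (0 < p i \<and> 0 < p j)" using False that by blast
      moreover have "0 \<le> p i" "0 \<le> p j" using that by (auto intro!: assms(1))
      ultimately show ?thesis by linarith
    qed
    have "?Q n i j = 0" if "(i, j) \<in> ?S" for n i j
      using that null[OF that] by (intro expected_cross_null[OF assms(1,3)]) auto
    then have "(\<Sum>(i, j)\<in>?S. ?Q n i j) = 0" for n by (intro sum.neutral) auto
    moreover have "edge_rate (p i) (p j) = 0" if "(i, j) \<in> ?S" for i j
      using null[OF that] by (auto simp: edge_rate_def)
    then have "?r = 0" by (intro sum.neutral) auto
    ultimately show ?thesis by (simp add: EX)
  qed
qed

end
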